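(* Let $R$ be a finite valuation ring with residue field of odd size $q$ and with uniformizer of nilpotency degree $\ell$, and let $n\geq 2$. For non-empty $A,B\subseteq R^n$ let $N_1(A,B)=|\{(a,b)\in A\times B: a\cdot b=1\}|$, where $a\cdot b=\sum_i a_ib_i$. Then \[ \big|N_1(A,B)-q^{-\ell}|A||B|\big|<q^{(n-1)(\ell-1/2)}\sqrt{|A||B|}. \] In particular, $1\in A\cdot B=\{a\cdot b:a\in A,b\in B\}$ whenever $\delta(A)\,\delta(B)\geq q^{-(n-1)}$, where $\delta(A)=|A|/|R^n|$.
   Context: Rings are commutative with identity. A finite valuation ring is a finite local principal ring; its maximal ideal is $(\pi)$, $q=|R/(\pi)|$, and $\ell$ is the smallest positive integer with $\pi^\ell=0$. *)

theory Defs
  imports Complex_Main "HOL-Algebra.QuotRing" "HOL-Library.FuncSet"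
begin

locale finite_valuation_ring = cring R for R (structure) +
  assumes finite_carrier: "finite (carrier R)"
    and local: "\<exists>!M. maximalideal M R"
    and principal: "\<And>I. ideal I R \<Longrightarrow> principalideal I R"

definition uniformizer :: "('r, 'm) ring_scheme \<Rightarrow> 'r \<Rightarrow> bool" where
  "uniformizer R p \<longleftrightarrow> p \<in> carrier R \<and> maximalideal (PIdl\<^bsub>R\<^esub> p) R"

definition nilpotency_degree :: "('r, 'm) ring_scheme \<Rightarrow> 'r \<Rightarrow> nat" where
  "nilpotency_degree R p = (LEAST l. 0 < l \<and> p [^]\<^bsub>R\<^esub> l = \<zero>\<^bsub>R\<^esub>)"

text \<open>Vectors are extensional functions on the index set \<open>{..<n}\<close>, so that
  distinct functions are distinct vectors and cardinalities are the intended ones.\<close>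

definition vectors :: "('r, 'm) ring_scheme \<Rightarrow> nat \<Rightarrow> (nat \<Rightarrow> 'r) set" where
  "vectors R n = {..<n} \<rightarrow>\<^sub>E carrier R"

definition dot :: "('r, 'm) ring_scheme \<Rightarrow> nat \<Rightarrow> (nat \<Rightarrow> 'r) \<Rightarrow> (nat \<Rightarrow> 'r) \<Rightarrow> 'r" where
  "dot R n a b = (\<Oplus>\<^bsub>R\<^esub>i\<in>{..<n}. a i \<otimes>\<^bsub>R\<^esub> b i)"

definition N1 :: "('r, 'm) ring_scheme \<Rightarrow> nat \<Rightarrow> (nat \<Rightarrow> 'r) set \<Rightarrow> (nat \<Rightarrow> 'r) set \<Rightarrow> nat" where
  "N1 R n A B = card {(a, b) \<in> A \<times> B. dot R n a b = \<one>\<^bsub>R\<^esub>}"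

definition dot_set ::
  "('r, 'm) ring_scheme \<Rightarrow> nat \<Rightarrow> (nat \<Rightarrow> 'r) set \<Rightarrow> (nat \<Rightarrow> 'r) set \<Rightarrow> 'r set" where
  "dot_set R n A B = {dot R n a b | a b. a \<in> A \<and> b \<in> B}"

definition density :: "('r, 'm) ring_scheme \<Rightarrow> nat \<Rightarrow> (nat \<Rightarrow> 'r) set \<Rightarrow> real" where
  "density R n A = real (card A) / real (card (vectors R n))"

end

theory Submission
  imports Defs "HOL-Algebra.Product_Groups" "HOL-Analysis.Convex"
begin

text \<open>
  Write \<open>r = |R| = q\<^sup>l\<close>, let \<open>M\<close> be the maximal ideal, so \<open>|M| = q\<^bsup>l-1\<^esup>\<close>, and call a vector primitive if
  it has a unit coordinate. By Cauchy--Schwarz it suffices to bound the second moment over all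
  \<open>b\<close> of \<open>|{a \<in> A. a \<cdot> b = 1}| - |A| / r\<close>, which is the sum over \<open>a, a' \<in> A\<close> of the correlations of the
  events \<open>a \<cdot> b = 1\<close> and \<open>a' \<cdot> b = 1\<close>. Two non-primitive vectors have correlation \<open>r\<^bsup>n-2\<^esup>\<close>, and there are only
  \<open>|M|\<^sup>n\<close> of them; mixed pairs have correlation \<open>0\<close>, and so do two primitive vectors that are not parallel modulo \<open>M\<close>,
  since then \<open>b \<mapsto> (a \<cdot> b, a' \<cdot> b)\<close> is onto. The parallel pairs are counted by first choosing \<open>b\<close>: for each of the
  \<open>r\<^bsup>n-1\<^esup>\<close> solutions of \<open>a \<cdot> b = 1\<close>, a parallel \<open>a'\<close> with \<open>a' \<cdot> b = 1\<close> is congruent to \<open>a\<close> modulo \<open>M\<close>, so \<open>a' - a\<close> is one of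
  the \<open>|M|\<^bsup>n-1\<^esup>\<close> elements of \<open>M\<^sup>n\<close> orthogonal to \<open>b\<close>. Hence every row sum is less than
  \<open>(r |M|)\<^bsup>n-1\<^esup> = q\<^bsup>(n-1)(2l-1)\<^esup>\<close>, the square of the claimed constant.
\<close>

section \<open>Fibres of group homomorphisms, and ideals of finite rings\<close>

lemma (in group_hom) card_fibre_mult_card_image:
  assumes "finite (carrier G)" and "y \<in> h ` carrier G"
  shows "card {x \<in> carrier G. h x = y} * card (h ` carrier G) = card (carrier G)"
proof -
  have kernel_fibre: "card {x \<in> carrier G. h x = z} = card (kernel G H h)"
    if z: "z \<in> h ` carrier G" for z
  proof -
    from z obtain g where g: "g \<in> carrier G" "h g = z" by blast
    \<comment> \<open>Translation by a preimage \<open>g\<close> of \<open>z\<close> carries the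
      kernel onto the fibre, so all nonempty fibres have equal size.\<close>
    have "bij_betw (\<lambda>x. x \<otimes> g) (kernel G H h) {x \<in> carrier G. h x = z}"
    proof (rule bij_betw_byWitness[where f' = "\<lambda>x. x \<otimes> inv g"])
      show "\<forall>x\<in>kernel G H h. x \<otimes> g \<otimes> inv g = x"
        using g by (simp add: kernel_def G.m_assoc)
      show "\<forall>x\<in>{x \<in> carrier G. h x = z}. x \<otimes> inv g \<otimes> g = x"
        using g by (simp add: G.m_assoc)
      show "(\<lambda>x. x \<otimes> g) ` kernel G H h \<subseteq> {x \<in> carrier G. h x = z}"
        using g by (clarsimp simp: kernel_def)
      show "(\<lambda>x. x \<otimes> inv g) ` {x \<in> carrier G. h x = z} \<subseteq> kernel G H h"
        using g by (clarsimp simp: kernel_def)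
    qed
    then show ?thesis by (metis bij_betw_same_card)
  qed
  have "card (carrier G) = (\<Sum>z \<in> h ` carrier G. card {x \<in> carrier G. h x = z})"
    using sum.group[OF assms(1) finite_imageI[OF assms(1)] subset_refl, where g = h and h = "\<lambda>_. 1::nat"]
    by simp
  also have "\<dots> = card (h ` carrier G) * card (kernel G H h)"
    by (simp add: kernel_fibre)
  finally show ?thesis
    using kernel_fibre[OF assms(2)] by simp
qed

lemma (in ring) group_ideal:
  assumes "ideal I R" shows "group ((add_monoid R)\<lparr>carrier := I\<rparr>)"
  by (rule group.subgroup_imp_group[OF a_group additive_subgroup.a_subgroup[OF ideal.axioms(1)[OF assms]]])

lemma (in ring) ideal_subset: "ideal I R \<Longrightarrow> I \<subseteq> carrier R"
  by (simp add: additive_subgroup.a_subset ideal.axioms(1))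

lemma (in cring) mem_cgenideal_iff: "x \<in> PIdl a \<longleftrightarrow> (\<exists>y\<in>carrier R. x = y \<otimes> a)"
  unfolding cgenideal_def by blast

text \<open>Only finitely many ideals exist, so the proper ideals above \<open>I\<close> have an
  inclusion-maximal member; Zorn's lemma is avoided.\<close>

lemma (in cring) finite_proper_ideal_le_maximal:
  assumes fin: "finite (carrier R)" and I: "ideal I R" "I \<noteq> carrier R"
  shows "\<exists>J. maximalideal J R \<and> I \<subseteq> J"
proof -
  let ?S = "{J. ideal J R \<and> I \<subseteq> J \<and> J \<noteq> carrier R}"
  have "finite ?S"
    by (rule finite_subset[of _ "Pow (carrier R)"]) (use ideal_subset fin in auto)
  moreover have "?S \<noteq> {}" using I by auto
  ultimately obtain J where J: "J \<in> ?S" and max: "\<And>K. K \<in> ?S \<Longrightarrow> J \<subseteq> K \<Longrightarrow> J = K"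
    by (metis (no_types, lifting) finite_has_maximal)
  have "maximalideal J R"
    by (rule maximalidealI) (use J max in blast)+
  then show ?thesis using J by auto
qed

section \<open>Structure and cardinalities of a finite valuation ring\<close>

locale finite_valuation_ring_uniformizer = finite_valuation_ring +
  fixes p
  assumes uniformizer: "uniformizer R p"
begin

abbreviation "M \<equiv> PIdl p"

lemma p_closed [simp]: "p \<in> carrier R"
  using uniformizer by (simp add: uniformizer_def)

sublocale M: maximalideal M R
  using uniformizer by (simp add: uniformizer_def)

lemma one_notin_M: "\<one> \<notin> M"
  using M.I_notcarr M.one_imp_carrier by auto

text \<open>A nonunit generates a proper ideal; this lies in some maximal ideal, which by locality
  is \<open>M\<close>.\<close>

lemma unit_if_notin_M:
  assumes "x \<in> carrier R" "x \<notin> M"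
  shows "x \<in> Units R"
proof (rule ccontr)
  assume x: "x \<notin> Units R"
  have "\<one> \<notin> PIdl x"
    unfolding mem_cgenideal_iff using x assms(1) m_comm unfolding Units_def by fastforce
  then obtain J where J: "maximalideal J R" "PIdl x \<subseteq> J"
    using finite_proper_ideal_le_maximal[OF finite_carrier cgenideal_ideal[OF assms(1)]] by auto
  then have "J = M"
    using local M.is_maximalideal by auto
  then show False
    using J(2) cgenideal_self[OF assms(1)] assms(2) by auto
qed

text \<open>By finiteness two powers of \<open>p\<close> coincide, say \<open>p^i = p^(i+m)\<close>
  with \<open>m > 0\<close>. Then \<open>(1 - p^m) p^i = 0\<close>, and \<open>1 - p^m\<close> is a
  unit because it lies outside \<open>M\<close>.\<close>

lemma p_nilpotent: "\<exists>k>0. p [^] (k::nat) = \<zero>"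
proof -
  have "\<not> inj (\<lambda>k::nat. p [^] k)"
    using finite_subset[OF _ finite_carrier, of "range (\<lambda>k::nat. p [^] k)"] finite_imageD
    by (metis image_subsetI infinite_UNIV_nat nat_pow_closed p_closed)
  then obtain i j :: nat where "p [^] i = p [^] j" "i < j"
    by (metis (no_types, lifting) injI linorder_neqE_nat)
  then obtain m where m: "p [^] i = p [^] (i + m)" "m > 0"
    by (metis less_imp_add_positive)
  have "p [^] m \<in> M"
    unfolding mem_cgenideal_iff using m(2) by (metis gr0_implies_Suc nat_pow_Suc nat_pow_closed p_closed)
  then have "\<one> \<ominus> p [^] m \<notin> M"
    using M.a_closed[of "\<one> \<ominus> p [^] m" "p [^] m"] one_notin_M by (auto simp: a_minus_def a_assoc l_neg)
  then have u: "\<one> \<ominus> p [^] m \<in> Units R"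
    by (simp add: unit_if_notin_M)
  have "(\<one> \<ominus> p [^] m) \<otimes> p [^] i = p [^] i \<ominus> p [^] (i + m)"
    by (simp add: a_minus_def l_distr l_minus flip: nat_pow_mult) (simp add: m_comm)
  also have "\<dots> = \<zero>"
    by (simp add: a_minus_def r_neg flip: m(1))
  finally have "p [^] i = \<zero>"
    using u by (metis Units_closed Units_l_cancel nat_pow_closed p_closed r_null zero_closed)
  then show ?thesis
    \<comment> \<open>\<open>i\<close> may be 0, while the exponent has to be positive.\<close>
    by (intro exI[of _ "Suc i"]) simp
qed

abbreviation "l \<equiv> nilpotency_degree R p"
abbreviation "q \<equiv> card (carrier (R Quot M))"

lemma l_pos: "0 < l" and p_pow_l: "p [^] l = \<zero>"
  using LeastI_ex[OF p_nilpotent] by (auto simp: nilpotency_degree_def)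

lemma l_le: "0 < k \<Longrightarrow> p [^] k = \<zero> \<Longrightarrow> l \<le> k"
  by (simp add: nilpotency_degree_def Least_le)

text \<open>Take the largest \<open>j\<close> such that \<open>p^j\<close> divides \<open>x\<close>;
  it exists because \<open>p^j = 0\<close> from \<open>l\<close> on. A cofactor in \<open>M\<close>
  would contribute one more factor \<open>p\<close>, so the cofactor is a unit.\<close>

lemma nonzero_eq_unit_mult_p_pow:
  assumes "x \<in> carrier R" "x \<noteq> \<zero>"
  obtains u j where "u \<in> Units R" "x = u \<otimes> p [^] (j::nat)"
proof -
  let ?P = "\<lambda>j::nat. \<exists>y\<in>carrier R. x = y \<otimes> p [^] j"
  have b: "\<not> ?P j" if "j \<ge> l" for j
  proof -
    have "p [^] j = \<zero>"
      using that p_pow_l nat_pow_mult[of p l "j - l"] by simp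
    then show ?thesis using assms by auto
  qed
  have "?P 0" using assms by auto
  define j where "j = Greatest ?P"
  have bound: "i \<le> l" if "?P i" for i
    using b that nle_le by blast
  have "?P j"
    unfolding j_def by (rule GreatestI_nat[where P = ?P and b = l, OF \<open>?P 0\<close>]) (rule bound)
  moreover have j: "i \<le> j" if "?P i" for i
    unfolding j_def by (rule Greatest_le_nat[where P = ?P and b = l, OF that]) (rule bound)
  ultimately obtain y where y: "y \<in> carrier R" "x = y \<otimes> p [^] j" by blast
  have "y \<notin> M"
  proof
    assume "y \<in> M"
    then obtain z where z: "z \<in> carrier R" "y = z \<otimes> p" unfolding mem_cgenideal_iff by blast
    have "x = z \<otimes> p [^] Suc j"
      using y z by (simp add: m_ac)
    then show False using j[of "Suc j"] z(1) by auto
  qed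
  then show ?thesis using that y unit_if_notin_M by blast
qed

text \<open>If \<open>x = u p^j\<close> with \<open>u\<close> a unit is killed by \<open>p\<close>,
  then \<open>p^(j+1) = 0\<close>, so \<open>l \<le> j + 1\<close> by minimality and
  \<open>k < l\<close> gives \<open>k \<le> j\<close>.\<close>

lemma annihilator_p_subset:
  assumes "x \<in> carrier R" "x \<otimes> p = \<zero>" "k < l"
  shows "x \<in> PIdl (p [^] k)"
proof (cases "x = \<zero>")
  case True
  then show ?thesis
    by (metis additive_subgroup.zero_closed cgenideal_ideal ideal.axioms(1) nat_pow_closed p_closed)
next
  case False
  then obtain u j where u: "u \<in> Units R" "x = u \<otimes> p [^] (j::nat)"
    using assms(1) nonzero_eq_unit_mult_p_pow by metis
  then have "u \<otimes> p [^] Suc j = \<zero>"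
    using assms(2) by (simp add: m_assoc Units_closed)
  then have "p [^] Suc j = \<zero>"
    using u by (metis Units_closed Units_l_cancel nat_pow_closed p_closed r_null zero_closed)
  then have "k \<le> j"
    using l_le[of "Suc j"] assms(3) by simp
  then have "p [^] j = p [^] (j - k) \<otimes> p [^] k"
    by (simp add: nat_pow_mult)
  then show ?thesis
    unfolding mem_cgenideal_iff using u
    by (intro bexI[of _ "u \<otimes> p [^] (j - k)"]) (simp_all add: m_assoc Units_closed)
qed

text \<open>Multiplication by \<open>p\<close> maps the ideal of \<open>p^k\<close> onto that of
  \<open>p^(k+1)\<close>. The point is that its kernel does not depend on \<open>k < l\<close>, so
  each step of the chain of ideals shrinks by the same factor.\<close>

lemma card_p_power_ideal:
  assumes "k < l"
  shows "card {x \<in> carrier R. x \<otimes> p = \<zero>} * card (PIdl (p [^] Suc k)) = card (PIdl (p [^] k))"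
proof -
  let ?G = "(add_monoid R)\<lparr>carrier := PIdl (p [^] k)\<rparr>"
  have I: "ideal (PIdl (p [^] k)) R" by (simp add: cgenideal_ideal)
  have sub: "x \<in> carrier R" if "x \<in> PIdl (p [^] k)" for x
    using that ideal_subset[OF I] by blast
  have "(\<lambda>x. x \<otimes> p) \<in> hom ?G (add_monoid R)"
    by (rule homI) (simp_all add: sub l_distr)
  then interpret h: group_hom ?G "add_monoid R" "\<lambda>x. x \<otimes> p"
    by (intro group_hom.intro group_hom_axioms.intro group_ideal I a_group)
  have im: "(\<lambda>x. x \<otimes> p) ` (PIdl (p [^] k)) = PIdl (p [^] Suc k)"
  proof (intro equalityI subsetI)
    fix y assume "y \<in> (\<lambda>x. x \<otimes> p) ` (PIdl (p [^] k))"
    then obtain x where "x \<in> PIdl (p [^] k)" "y = x \<otimes> p" by blast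
    then show "y \<in> PIdl (p [^] Suc k)"
      unfolding mem_cgenideal_iff by (metis m_assoc nat_pow_Suc nat_pow_closed p_closed)
  next
    fix y assume "y \<in> PIdl (p [^] Suc k)"
    then obtain x where x: "x \<in> carrier R" "y = x \<otimes> p [^] Suc k"
      unfolding mem_cgenideal_iff by blast
    then have "x \<otimes> p [^] k \<in> PIdl (p [^] k)" "y = (x \<otimes> p [^] k) \<otimes> p"
      unfolding mem_cgenideal_iff by (blast, simp add: m_assoc)
    then show "y \<in> (\<lambda>x. x \<otimes> p) ` (PIdl (p [^] k))" by blast
  qed
  \<comment> \<open>For \<open>k < l\<close> the whole annihilator of \<open>p\<close> already lies
    inside the ideal of \<open>p^k\<close>.\<close>
  have "{x \<in> PIdl (p [^] k). x \<otimes> p = \<zero>} = {x \<in> carrier R. x \<otimes> p = \<zero>}"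
    using annihilator_p_subset[OF _ _ assms] sub by blast
  moreover have "\<zero> \<in> (\<lambda>x. x \<otimes> p) ` (PIdl (p [^] k))"
    unfolding im by (intro additive_subgroup.zero_closed ideal.axioms(1) cgenideal_ideal nat_pow_closed p_closed)
  ultimately show ?thesis
    using h.card_fibre_mult_card_image[of \<zero>] finite_subset[OF ideal_subset[OF I] finite_carrier]
    by (simp add: im del: nat_pow_Suc)
qed

lemma card_quotient_mult: "q * card M = card (carrier R)"
  using a_lagrange[OF finite_carrier M.additive_subgroup_axioms]
  unfolding FactRing_def order_def by simp

lemma cgenideal_one: "PIdl \<one> = carrier R"
  unfolding cgenideal_def by force

lemma cgenideal_zero: "PIdl \<zero> = {\<zero>}"
  unfolding cgenideal_def by force

lemma finite_M: "finite M"
  by (rule finite_subset[OF M.a_subset finite_carrier])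

lemma card_M_pos: "card M > 0"
  using finite_M M.zero_closed by (metis card_gt_0_iff empty_iff)

lemma card_M_less: "card M < card (carrier R)"
  using M.a_subset one_closed one_notin_M by (intro psubset_card_mono[OF finite_carrier]) blast

text \<open>The first step of the chain, from \<open>R\<close> to \<open>M\<close>, shrinks by the
  index \<open>q\<close> of \<open>M\<close>, which identifies the common factor.\<close>

lemma card_annihilator: "card {x \<in> carrier R. x \<otimes> p = \<zero>} = q"
proof -
  have "card {x \<in> carrier R. x \<otimes> p = \<zero>} * card M = q * card M"
    using card_p_power_ideal[OF l_pos] by (simp add: cgenideal_one card_quotient_mult)
  then show ?thesis using card_M_pos by simp
qed

lemma card_p_power: "k \<le> l \<Longrightarrow> card (PIdl (p [^] k)) = q ^ (l - k)"
proof (induction rule: inc_induct)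
  case base
  show ?case by (simp add: p_pow_l cgenideal_zero)
next
  case (step k)
  then show ?case
    using card_p_power_ideal[of k] card_annihilator
    by (metis Suc_diff_Suc power_Suc)
qed

lemma card_carrier: "card (carrier R) = q ^ l"
  using card_p_power[of 0] by (simp add: cgenideal_one)

lemma card_M: "card M = q ^ (l - 1)"
  using card_p_power[of 1] l_pos by simp

lemma q_gt_1: "q > 1"
  using card_M_less unfolding card_quotient_mult[symmetric] by simp

end

section \<open>Dot products over a commutative ring and the sizes of their fibres\<close>

lemma (in ring) finsum_in_ideal:
  assumes "ideal I R" "finite S" "\<And>i. i \<in> S \<Longrightarrow> f i \<in> I"
  shows "(\<Oplus>i\<in>S. f i) \<in> I"
proof -
  interpret I: ideal I R by fact
  show ?thesis
    using assms(2,3)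
  proof (induction S rule: finite_induct)
    case empty
    then show ?case by simp
  next
    case (insert i S)
    then have "finsum R f (insert i S) = f i \<oplus> finsum R f S"
      using I.a_Hcarr by (intro finsum_insert) auto
    then show ?case
      using insert by simp
  qed
qed

context cring
begin

lemma vectors_nth: "a \<in> vectors R n \<Longrightarrow> i < n \<Longrightarrow> a i \<in> carrier R"
  unfolding vectors_def by (auto simp: PiE_iff)

lemma dot_closed: "a \<in> vectors R n \<Longrightarrow> b \<in> vectors R n \<Longrightarrow> dot R n a b \<in> carrier R"
  unfolding dot_def by (intro finsum_closed) (simp add: vectors_nth)

lemma dot_commute: "a \<in> vectors R n \<Longrightarrow> b \<in> vectors R n \<Longrightarrow> dot R n a b = dot R n b a"
  unfolding dot_def by (intro finsum_cong') (simp_all add: vectors_nth m_comm)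

lemma vectors_ideal_subset: "ideal I R \<Longrightarrow> w \<in> {..<n} \<rightarrow>\<^sub>E I \<Longrightarrow> w \<in> vectors R n"
  unfolding vectors_def using ideal_subset by (auto simp: PiE_iff)

lemma dot_in_ideal:
  assumes "ideal I R" "a \<in> vectors R n" "w \<in> {..<n} \<rightarrow>\<^sub>E I"
  shows "dot R n a w \<in> I"
  unfolding dot_def
proof (rule finsum_in_ideal[OF assms(1)])
  fix i assume "i \<in> {..<n}"
  then show "a i \<otimes> w i \<in> I"
    using assms by (auto simp: PiE_iff vectors_nth intro: ideal.I_l_closed)
qed simp

lemma dot_single:
  assumes "a \<in> vectors R n" "i < n" "x \<in> carrier R"
  shows "dot R n a (\<lambda>j\<in>{..<n}. if j = i then x else \<zero>) = a i \<otimes> x"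
proof -
  have "dot R n a (\<lambda>j\<in>{..<n}. if j = i then x else \<zero>)
      = (\<Oplus>j\<in>{..<n}. if i = j then a j \<otimes> x else \<zero>)"
    unfolding dot_def using assms by (intro finsum_cong') (auto simp: vectors_nth)
  also have "\<dots> = a i \<otimes> x"
    using assms by (intro finsum_singleton) (auto simp: vectors_nth)
  finally show ?thesis .
qed

lemma dot_add:
  assumes "a \<in> vectors R n" "b \<in> vectors R n" "c \<in> vectors R n"
  shows "dot R n a (\<lambda>j\<in>{..<n}. b j \<oplus> c j) = dot R n a b \<oplus> dot R n a c"
proof -
  have "dot R n a (\<lambda>j\<in>{..<n}. b j \<oplus> c j) = (\<Oplus>j\<in>{..<n}. a j \<otimes> b j \<oplus> a j \<otimes> c j)"
    unfolding dot_def using assms by (intro finsum_cong') (auto simp: vectors_nth r_distr)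
  also have "\<dots> = dot R n a b \<oplus> dot R n a c"
    unfolding dot_def using assms by (intro finsum_addf) (auto simp: vectors_nth)
  finally show ?thesis .
qed

text \<open>The additive group \<open>I^n\<close>. Its carrier consists of extensional functions, so
  for \<open>I = carrier R\<close> it is exactly \<open>vectors R n\<close>.\<close>

abbreviation ideal_vectors :: "'a set \<Rightarrow> nat \<Rightarrow> (nat \<Rightarrow> 'a) monoid" where
  "ideal_vectors I n \<equiv> product_group {..<n} (\<lambda>_. (add_monoid R)\<lparr>carrier := I\<rparr>)"

lemma group_ideal_vectors:
  assumes "ideal I R"
  shows "group (ideal_vectors I n)"
  by (rule product_group) (rule group_ideal[OF assms])

lemma dot_hom:
  assumes "ideal I R" "a \<in> vectors R n"
  shows "dot R n a \<in> hom (ideal_vectors I n) (add_monoid R)"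
proof (rule homI)
  fix b c assume "b \<in> carrier (ideal_vectors I n)" "c \<in> carrier (ideal_vectors I n)"
  then show "dot R n a (b \<otimes>\<^bsub>ideal_vectors I n\<^esub> c) = dot R n a b \<otimes>\<^bsub>add_monoid R\<^esub> dot R n a c"
    using dot_add[OF assms(2)] vectors_ideal_subset[OF assms(1)] by simp
qed (use assms vectors_ideal_subset dot_closed in auto)

lemma finite_vectors: "finite (carrier R) \<Longrightarrow> finite (vectors R n)"
  unfolding vectors_def by (simp add: finite_PiE)

lemma card_vectors: "card (vectors R n) = card (carrier R) ^ n"
  unfolding vectors_def by (simp add: card_PiE)

text \<open>The unit coordinate makes \<open>w \<mapsto> a \<cdot> w\<close> map \<open>I^n\<close>
  onto \<open>I\<close>, so all fibres have equal size. Two cases matter later: \<open>I = R\<close>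
  counts solutions of \<open>a \<cdot> b = 1\<close>, and \<open>I = M\<close> counts vectors of
  \<open>M^n\<close> orthogonal to a given one. The product form avoids the truncated exponent
  \<open>n - 1\<close>.\<close>

lemma card_dot_fibre:
  assumes "finite (carrier R)" "ideal I R" "a \<in> vectors R n" "i < n" "a i \<in> Units R" "y \<in> I"
  shows "card {w \<in> {..<n} \<rightarrow>\<^sub>E I. dot R n a w = y} * card I = card I ^ n"
proof -
  interpret I: ideal I R by fact
  interpret h: group_hom "ideal_vectors I n" "add_monoid R" "dot R n a"
    using assms by (intro group_hom.intro group_hom_axioms.intro group_ideal_vectors a_group dot_hom)
  have fin: "finite I"
    by (rule finite_subset[OF I.a_subset assms(1)])
  have im: "dot R n a ` ({..<n} \<rightarrow>\<^sub>E I) = I"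
  proof (intro equalityI subsetI)
    fix x assume x: "x \<in> I"
    then have xc: "x \<in> carrier R" by (rule I.a_Hcarr)
    \<comment> \<open>Put all the weight on the unit coordinate; the entry stays in \<open>I\<close>
      because \<open>x\<close> does.\<close>
    let ?w = "\<lambda>j\<in>{..<n}. if j = i then inv (a i) \<otimes> x else \<zero>"
    have "dot R n a ?w = a i \<otimes> (inv (a i) \<otimes> x)"
      using assms xc by (intro dot_single) simp_all
    also have "\<dots> = x"
      using assms(5) xc by (simp add: Units_closed flip: m_assoc)
    finally have "x = dot R n a ?w" by simp
    moreover have "?w \<in> {..<n} \<rightarrow>\<^sub>E I"
      using x assms(5) by (auto simp: I.I_l_closed)
    ultimately show "x \<in> dot R n a ` ({..<n} \<rightarrow>\<^sub>E I)" by (rule image_eqI)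
  qed (use dot_in_ideal[OF assms(2,3)] in blast)
  show ?thesis
    using h.card_fibre_mult_card_image[of y] assms(6) fin
    by (simp add: im finite_PiE card_PiE)
qed

text \<open>An invertible 2 by 2 minor lets the two dot products be prescribed independently, so the
  pair maps onto \<open>R \<times> R\<close> and every fibre has the same size.\<close>

lemma card_dot_fibre_pair:
  assumes fin: "finite (carrier R)" and a: "a \<in> vectors R n" and b: "b \<in> vectors R n"
    and ij: "i < n" "j < n" and u: "a i \<otimes> b j \<ominus> a j \<otimes> b i \<in> Units R"
    and st: "s \<in> carrier R" "t \<in> carrier R"
  shows "card {w \<in> vectors R n. dot R n a w = s \<and> dot R n b w = t} * card (carrier R) ^ 2
    = card (carrier R) ^ n"
proof -
  let ?h = "\<lambda>w. (dot R n a w, dot R n b w)" and ?H = "add_monoid R \<times>\<times> add_monoid R"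
  let ?G = "ideal_vectors (carrier R) n"
  have V: "carrier ?G = vectors R n"
    by (simp add: vectors_def)
  have "?h \<in> hom ?G ?H"
    using dot_hom[OF oneideal a] dot_hom[OF oneideal b] by (simp add: hom_def Pi_iff del: mult_product_group)
  then interpret h: group_hom ?G ?H ?h
    by (intro group_hom.intro group_hom_axioms.intro group_ideal_vectors DirProd_group a_group oneideal)
  define d where "d = inv (a i \<otimes> b j \<ominus> a j \<otimes> b i)"
  have d: "d \<in> carrier R" "d \<otimes> (a i \<otimes> b j \<ominus> a j \<otimes> b i) = \<one>"
    using u by (simp_all add: d_def)
  note ab = vectors_nth[OF a ij(1)] vectors_nth[OF a ij(2)] vectors_nth[OF b ij(1)] vectors_nth[OF b ij(2)]
  have im: "?h ` vectors R n = carrier R \<times> carrier R"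
  proof (intro equalityI subsetI)
    fix z assume "z \<in> carrier R \<times> carrier R"
    then obtain x y where z: "z = (x, y)" and xy: "x \<in> carrier R" "y \<in> carrier R" by blast
    let ?e = "\<lambda>k c. \<lambda>j\<in>{..<n}. if j = k then c else \<zero>"
    \<comment> \<open>Cramer's rule in the coordinates \<open>i\<close>, \<open>j\<close>\<close>
    define f g where "f = d \<otimes> (x \<otimes> b j \<ominus> y \<otimes> a j)" and "g = d \<otimes> (y \<otimes> a i \<ominus> x \<otimes> b i)"
    have fg: "f \<in> carrier R" "g \<in> carrier R"
      using d ab xy by (simp_all add: f_def g_def)
    have e: "?e k c \<in> vectors R n" if "c \<in> carrier R" for k c
      using that by (auto simp: vectors_def)
    let ?w = "\<lambda>k\<in>{..<n}. ?e i f k \<oplus> ?e j g k"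
    have w: "?w \<in> vectors R n"
      using fg by (auto simp: vectors_def)
    have "dot R n a ?w = a i \<otimes> f \<oplus> a j \<otimes> g"
      using dot_add[OF a e[OF fg(1)] e[OF fg(2)]] dot_single[OF a] ij fg by simp
    also have "\<dots> = x \<otimes> (d \<otimes> (a i \<otimes> b j \<ominus> a j \<otimes> b i))"
      unfolding f_def g_def using d(1) ab xy by algebra
    finally have 1: "dot R n a ?w = x" using d xy by simp
    have "dot R n b ?w = b i \<otimes> f \<oplus> b j \<otimes> g"
      using dot_add[OF b e[OF fg(1)] e[OF fg(2)]] dot_single[OF b] ij fg by simp
    also have "\<dots> = y \<otimes> (d \<otimes> (a i \<otimes> b j \<ominus> a j \<otimes> b i))"
      unfolding f_def g_def using d(1) ab xy by algebra
    finally have 2: "dot R n b ?w = y" using d xy by simp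
    show "z \<in> ?h ` vectors R n"
      by (rule image_eqI[OF _ w]) (simp only: z 1 2)
  qed (use dot_closed a b in auto)
  have "(s, t) \<in> ?h ` carrier ?G"
    unfolding V im using st by simp
  then have "card {w \<in> vectors R n. ?h w = (s, t)} * card (carrier R \<times> carrier R) = card (vectors R n)"
    using h.card_fibre_mult_card_image[of "(s, t)"] finite_vectors[OF fin] unfolding V im by simp
  then show ?thesis
    by (simp add: card_cartesian_product card_vectors power2_eq_square)
qed

text \<open>Weighting the minors with fixed \<open>j\<close> by \<open>b i\<close> and summing over
  \<open>i\<close> gives \<open>a' j (a \<cdot> b) - a j (a' \<cdot> b)\<close>, which is
  \<open>a' j - a j\<close> when both dot products are 1.\<close>

lemma diff_in_ideal_if_minors_in_ideal:
  assumes I: "ideal I R" and a: "a \<in> vectors R n" and a': "a' \<in> vectors R n" and b: "b \<in> vectors R n"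
    and minors: "\<And>i j. i < n \<Longrightarrow> j < n \<Longrightarrow> a i \<otimes> a' j \<ominus> a j \<otimes> a' i \<in> I"
    and eq: "dot R n a b = \<one>" "dot R n a' b = \<one>" and j: "j < n"
  shows "a' j \<ominus> a j \<in> I"
proof -
  note cl = vectors_nth[OF a] vectors_nth[OF a'] vectors_nth[OF b]
  have "(\<Oplus>i\<in>{..<n}. (a i \<otimes> a' j \<ominus> a j \<otimes> a' i) \<otimes> b i)
      = (\<Oplus>i\<in>{..<n}. a' j \<otimes> (a i \<otimes> b i) \<oplus> (\<ominus> a j) \<otimes> (a' i \<otimes> b i))"
  proof (rule finsum_cong')
    fix i assume "i \<in> {..<n}"
    then have "a i \<in> carrier R" "a' i \<in> carrier R" "b i \<in> carrier R" "a j \<in> carrier R" "a' j \<in> carrier R"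
      using cl j by auto
    then show "(a i \<otimes> a' j \<ominus> a j \<otimes> a' i) \<otimes> b i = a' j \<otimes> (a i \<otimes> b i) \<oplus> (\<ominus> a j) \<otimes> (a' i \<otimes> b i)"
      by algebra
  qed (use cl j in auto)
  also have "\<dots> = (\<Oplus>i\<in>{..<n}. a' j \<otimes> (a i \<otimes> b i)) \<oplus> (\<Oplus>i\<in>{..<n}. (\<ominus> a j) \<otimes> (a' i \<otimes> b i))"
    using cl j by (intro finsum_addf) auto
  also have "\<dots> = a' j \<otimes> dot R n a b \<oplus> (\<ominus> a j) \<otimes> dot R n a' b"
    unfolding dot_def using cl j by (subst (1 2) finsum_rdistr) auto
  also have "\<dots> = a' j \<ominus> a j"
    using cl j by (simp add: eq a_minus_def)
  finally have "a' j \<ominus> a j = (\<Oplus>i\<in>{..<n}. (a i \<otimes> a' j \<ominus> a j \<otimes> a' i) \<otimes> b i)" ..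
  also have "\<dots> \<in> I"
    using cl minors[OF _ j] ideal.I_r_closed[OF I] by (intro finsum_in_ideal[OF I]) auto
  finally show ?thesis .
qed

end

section \<open>Counting solutions for primitive and parallel vectors\<close>

context finite_valuation_ring_uniformizer
begin

definition primitive :: "nat \<Rightarrow> (nat \<Rightarrow> 'a) \<Rightarrow> bool" where
  "primitive n a \<longleftrightarrow> (\<exists>i<n. a i \<notin> M)"

text \<open>Linear dependence of the reductions over the residue field \<open>R/M\<close>, expressed
  by vanishing minors.\<close>

definition parallel :: "nat \<Rightarrow> (nat \<Rightarrow> 'a) \<Rightarrow> (nat \<Rightarrow> 'a) \<Rightarrow> bool" where
  "parallel n a b \<longleftrightarrow> (\<forall>i<n. \<forall>j<n. a i \<otimes> b j \<ominus> a j \<otimes> b i \<in> M)"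

lemma primitive_unit:
  assumes "a \<in> vectors R n" "primitive n a"
  obtains i where "i < n" "a i \<in> Units R"
  using assms unfolding primitive_def by (meson unit_if_notin_M vectors_nth)

lemma parallel_refl: "a \<in> vectors R n \<Longrightarrow> parallel n a a"
  unfolding parallel_def by (simp add: vectors_nth m_comm[of "a _" "a _"] a_minus_def r_neg)

lemma not_primitive_vectors: "{a \<in> vectors R n. \<not> primitive n a} = {..<n} \<rightarrow>\<^sub>E M"
proof (intro equalityI subsetI)
  fix a assume "a \<in> {..<n} \<rightarrow>\<^sub>E M"
  then show "a \<in> {a \<in> vectors R n. \<not> primitive n a}"
    using vectors_ideal_subset[OF M.is_ideal] unfolding primitive_def by blast
next
  fix a assume "a \<in> {a \<in> vectors R n. \<not> primitive n a}"
  then show "a \<in> {..<n} \<rightarrow>\<^sub>E M"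
    unfolding vectors_def primitive_def PiE_iff by blast
qed

lemma card_not_primitive: "card {a \<in> vectors R n. \<not> primitive n a} = card M ^ n"
  unfolding not_primitive_vectors by (simp add: card_PiE)

lemma dot_not_primitive:
  assumes "a \<in> vectors R n" "b \<in> vectors R n" "\<not> primitive n a"
  shows "dot R n b a \<noteq> \<one>"
proof -
  have "a \<in> {..<n} \<rightarrow>\<^sub>E M"
    using assms not_primitive_vectors by blast
  then show ?thesis
    using dot_in_ideal[OF M.is_ideal assms(2)] one_notin_M by metis
qed

lemma card_solutions_primitive:
  assumes "a \<in> vectors R n" "primitive n a"
  shows "card {b \<in> vectors R n. dot R n a b = \<one>} * card (carrier R) = card (carrier R) ^ n"
proof -
  obtain i where "i < n" "a i \<in> Units R"
    using primitive_unit assms by blast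
  then show ?thesis
    using card_dot_fibre[OF finite_carrier oneideal assms(1) _ _ one_closed] by (simp add: vectors_def)
qed

lemma card_solutions_not_parallel:
  assumes "a \<in> vectors R n" "a' \<in> vectors R n" "\<not> parallel n a a'"
  shows "card {b \<in> vectors R n. dot R n a b = \<one> \<and> dot R n a' b = \<one>} * card (carrier R) ^ 2
    = card (carrier R) ^ n"
proof -
  obtain i j where ij: "i < n" "j < n" "a i \<otimes> a' j \<ominus> a j \<otimes> a' i \<notin> M"
    using assms(3) unfolding parallel_def by blast
  then have "a i \<otimes> a' j \<ominus> a j \<otimes> a' i \<in> Units R"
    using assms by (intro unit_if_notin_M) (simp_all add: vectors_nth)
  then show ?thesis
    using card_dot_fibre_pair[OF finite_carrier assms(1,2) ij(1,2) _ one_closed one_closed] by simp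
qed

text \<open>Subtracting \<open>a\<close> embeds the set into \<open>?K\<close>: the minor identity
  puts the difference in \<open>M^n\<close>, and equal dot products make it orthogonal to
  \<open>b\<close>.\<close>

lemma card_parallel_solutions_le:
  assumes a: "a \<in> vectors R n" and b: "b \<in> vectors R n" and ab: "dot R n a b = \<one>"
  shows "card {a' \<in> vectors R n. parallel n a a' \<and> dot R n a' b = \<one>} * card M \<le> card M ^ n"
proof -
  let ?S = "{a' \<in> vectors R n. parallel n a a' \<and> dot R n a' b = \<one>}"
  let ?K = "{w \<in> {..<n} \<rightarrow>\<^sub>E M. dot R n b w = \<zero>}"
  let ?f = "\<lambda>a'. \<lambda>j\<in>{..<n}. a' j \<ominus> a j"
  \<comment> \<open>\<open>a \<cdot> b = 1\<close> forces a unit coordinate of \<open>b\<close>,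
    which is what makes \<open>?K\<close> countable by \<open>card_dot_fibre\<close>.\<close>
  have "primitive n b"
    using dot_not_primitive a b ab by blast
  then obtain i where i: "i < n" "b i \<in> Units R"
    using primitive_unit b by blast
  have "?f a' \<in> ?K" if a': "a' \<in> ?S" for a'
  proof -
    have a'V: "a' \<in> vectors R n" and par: "parallel n a a'" and a'b: "dot R n a' b = \<one>"
      using a' by auto
    have "a' j \<ominus> a j \<in> M" if "j < n" for j
      using diff_in_ideal_if_minors_in_ideal[OF M.is_ideal a a'V b _ ab a'b that] par
      unfolding parallel_def by blast
    then have f: "?f a' \<in> {..<n} \<rightarrow>\<^sub>E M" unfolding PiE_iff by simp
    then have fV: "?f a' \<in> vectors R n"
      by (rule vectors_ideal_subset[OF M.is_ideal])
    have "(\<lambda>j\<in>{..<n}. a j \<oplus> ?f a' j) = a'"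
    proof
      fix j
      show "(\<lambda>j\<in>{..<n}. a j \<oplus> ?f a' j) j = a' j"
      proof (cases "j < n")
        case True
        then have "a j \<in> carrier R" "a' j \<in> carrier R"
          using a a'V vectors_nth by blast+
        then have "a j \<oplus> (a' j \<ominus> a j) = a' j" by algebra
        then show ?thesis using True by simp
      next
        case False
        \<comment> \<open>Outside the index range both sides are \<open>undefined\<close>.\<close>
        then show ?thesis using a'V by (simp add: vectors_def PiE_iff extensional_def)
      qed
    qed
    then have "\<one> = \<one> \<oplus> dot R n b (?f a')"
      using dot_add[OF b a fV] dot_commute[OF a b] dot_commute[OF a'V b] ab a'b by simp
    then have "dot R n b (?f a') = \<zero>"
      using dot_closed[OF b fV] by (metis a_comm one_closed add.r_cancel_one')
    then show ?thesis using f by blast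
  qed
  moreover have "inj_on ?f ?S"
  proof (rule inj_onI)
    fix x y assume xy: "x \<in> ?S" "y \<in> ?S" "?f x = ?f y"
    have xV: "x \<in> vectors R n" and yV: "y \<in> vectors R n" using xy by auto
    show "x = y"
    proof (rule PiE_ext[OF xV[unfolded vectors_def] yV[unfolded vectors_def]])
      fix j assume j: "j \<in> {..<n}"
      then have c: "x j \<in> carrier R" "y j \<in> carrier R" "a j \<in> carrier R"
        using xV yV a vectors_nth by blast+
      have "x j \<ominus> a j = y j \<ominus> a j"
        using fun_cong[OF xy(3), of j] j by simp
      then show "x j = y j"
        using c by (simp add: a_minus_def)
    qed
  qed
  moreover have "finite ?K"
    using finite_M by (simp add: finite_PiE)
  ultimately have "card ?S \<le> card ?K"
    by (meson card_inj_on_le image_subsetI)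
  then have "card ?S * card M \<le> card ?K * card M" by simp
  also have "\<dots> = card M ^ n"
    by (rule card_dot_fibre[OF finite_carrier M.is_ideal b i M.zero_closed])
  finally show ?thesis .
qed

text \<open>Double counting: with \<open>b\<close> chosen first, the inner count has a bound uniform
  in \<open>b\<close>. The factors on the left stand in for the exponent
  \<open>n - 1\<close>.\<close>

lemma sum_parallel_solutions_le:
  assumes a: "a \<in> vectors R n" and prim: "primitive n a"
  shows "(\<Sum>a' \<in> {a' \<in> vectors R n. parallel n a a'}.
      card {b \<in> vectors R n. dot R n a b = \<one> \<and> dot R n a' b = \<one>}) * (card (carrier R) * card M)
    \<le> (card (carrier R) * card M) ^ n"
proof -
  let ?V = "vectors R n"
  have fin: "finite ?V" by (rule finite_vectors[OF finite_carrier])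
  have "(\<Sum>a' \<in> {a' \<in> ?V. parallel n a a'}. card {b \<in> ?V. dot R n a b = \<one> \<and> dot R n a' b = \<one>})
      = (\<Sum>a' \<in> {a' \<in> ?V. parallel n a a'}. \<Sum>b \<in> {b \<in> ?V. dot R n a b = \<one>}. of_bool (dot R n a' b = \<one>))"
    using fin by (intro sum.cong) (auto simp: sum_of_bool_eq Int_def intro!: arg_cong[where f = card])
  also have "\<dots> = (\<Sum>b \<in> {b \<in> ?V. dot R n a b = \<one>}. \<Sum>a' \<in> {a' \<in> ?V. parallel n a a'}. of_bool (dot R n a' b = \<one>))"
    by (rule sum.swap)
  also have "\<dots> = (\<Sum>b \<in> {b \<in> ?V. dot R n a b = \<one>}. card {a' \<in> ?V. parallel n a a' \<and> dot R n a' b = \<one>})"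
    using fin by (intro sum.cong) (auto simp: sum_of_bool_eq Int_def intro!: arg_cong[where f = card])
  finally have "(\<Sum>a' \<in> {a' \<in> ?V. parallel n a a'}.
      card {b \<in> ?V. dot R n a b = \<one> \<and> dot R n a' b = \<one>}) * card M
    = (\<Sum>b \<in> {b \<in> ?V. dot R n a b = \<one>}. card {a' \<in> ?V. parallel n a a' \<and> dot R n a' b = \<one>} * card M)"
    by (simp add: sum_distrib_right)
  also have "\<dots> \<le> (\<Sum>b \<in> {b \<in> ?V. dot R n a b = \<one>}. card M ^ n)"
    using a card_parallel_solutions_le by (intro sum_mono) blast
  also have "\<dots> = card {b \<in> ?V. dot R n a b = \<one>} * card M ^ n"
    by simp
  finally have "(\<Sum>a' \<in> {a' \<in> ?V. parallel n a a'}.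
      card {b \<in> ?V. dot R n a b = \<one> \<and> dot R n a' b = \<one>}) * card M * card (carrier R)
    \<le> card {b \<in> ?V. dot R n a b = \<one>} * card M ^ n * card (carrier R)"
    by (rule mult_le_mono1)
  also have "\<dots> = card (carrier R) ^ n * card M ^ n"
    by (simp add: mult.assoc mult.commute[of "card M ^ n"] flip: card_solutions_primitive[OF a prim])
  finally show ?thesis
    by (simp add: power_mult_distrib mult_ac)
qed

section \<open>Correlations and the second moment\<close>

definition deviation :: "nat \<Rightarrow> (nat \<Rightarrow> 'a) \<Rightarrow> (nat \<Rightarrow> 'a) \<Rightarrow> real" where
  "deviation n a b = of_bool (dot R n a b = \<one>) - 1 / real (card (carrier R))"

text \<open>An unnormalised covariance when both vectors are primitive, since then
  \<open>1 / |R|\<close> is the exact mean of each indicator over \<open>b\<close>. For a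
  non-primitive vector the indicator vanishes and \<open>deviation\<close> is constantly
  \<open>- 1 / |R|\<close>.\<close>

definition correlation :: "nat \<Rightarrow> (nat \<Rightarrow> 'a) \<Rightarrow> (nat \<Rightarrow> 'a) \<Rightarrow> real" where
  "correlation n a a' = (\<Sum>b \<in> vectors R n. deviation n a b * deviation n a' b)"

lemma card_carrier_pos: "card (carrier R) > 0"
  using finite_carrier zero_closed by (metis card_gt_0_iff empty_iff)

lemma correlation_eq:
  "correlation n a a' = real (card {b \<in> vectors R n. dot R n a b = \<one> \<and> dot R n a' b = \<one>})
     - real (card {b \<in> vectors R n. dot R n a b = \<one>}) / card (carrier R)
     - real (card {b \<in> vectors R n. dot R n a' b = \<one>}) / card (carrier R)
     + real (card (carrier R)) ^ n / real (card (carrier R)) ^ 2"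
proof -
  let ?r = "real (card (carrier R))"
  let ?V = "vectors R n"
  have fin: "finite ?V" by (rule finite_vectors[OF finite_carrier])
  have "correlation n a a' = (\<Sum>b \<in> ?V. of_bool (dot R n a b = \<one> \<and> dot R n a' b = \<one>)
      - of_bool (dot R n a b = \<one>) / ?r - of_bool (dot R n a' b = \<one>) / ?r + 1 / ?r ^ 2)"
    unfolding correlation_def deviation_def
    by (intro sum.cong) (auto simp: of_bool_def algebra_simps power2_eq_square)
  also have "\<dots> = (\<Sum>b \<in> ?V. of_bool (dot R n a b = \<one> \<and> dot R n a' b = \<one>))
      - (\<Sum>b \<in> ?V. of_bool (dot R n a b = \<one>)) / ?r - (\<Sum>b \<in> ?V. of_bool (dot R n a' b = \<one>)) / ?r
      + (\<Sum>b \<in> ?V. 1 / ?r ^ 2)"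
    by (simp only: sum.distrib sum_subtractf sum_divide_distrib)
  finally show ?thesis
    using fin by (simp add: sum_of_bool_eq Int_def card_vectors)
qed

text \<open>With \<open>r = |R|\<close>, a primitive vector has \<open>r^(n-1)\<close> solutions and
  a non-primitive one has none. In \<open>correlation_eq\<close> the constant \<open>r^(n-2)\<close>
  thus survives alone, cancels against the one nonzero single count, or is subtracted twice and
  added once.\<close>

lemma correlation_cases:
  assumes a: "a \<in> vectors R n" and a': "a' \<in> vectors R n" and n: "n \<ge> 2"
  shows "\<not> primitive n a \<Longrightarrow> \<not> primitive n a' \<Longrightarrow> correlation n a a' = real (card (carrier R)) ^ (n - 2)"
    and "primitive n a \<noteq> primitive n a' \<Longrightarrow> correlation n a a' = 0"
    and "primitive n a \<Longrightarrow> primitive n a' \<Longrightarrow> correlation n a a' =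
      real (card {b \<in> vectors R n. dot R n a b = \<one> \<and> dot R n a' b = \<one>}) - real (card (carrier R)) ^ (n - 2)"
proof -
  let ?r = "real (card (carrier R))"
  let ?V = "vectors R n"
  have r: "?r > 0" using card_carrier_pos by simp
  obtain k where k: "n = k + 2" using n by (metis le_add_diff_inverse2)
  have Q: "?r ^ n / ?r ^ 2 = ?r ^ (n - 2)"
    using r by (simp add: k power_add power2_eq_square)
  have prim: "real (card {b \<in> ?V. dot R n x b = \<one>}) / ?r = ?r ^ (n - 2)"
    if "x \<in> ?V" "primitive n x" for x
  proof -
    have "real (card {b \<in> ?V. dot R n x b = \<one>}) * ?r = ?r ^ n"
      using arg_cong[OF card_solutions_primitive[OF that], where f = real]
      by (simp only: of_nat_mult of_nat_power)
    then show ?thesis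
      using r by (simp add: Q[symmetric] power2_eq_square field_simps)
  qed
  have nprim: "{b \<in> ?V. dot R n x b = \<one>} = {}" "{b \<in> ?V. dot R n x b = \<one> \<and> P b} = {}"
    "{b \<in> ?V. P b \<and> dot R n x b = \<one>} = {}"
    if "x \<in> ?V" "\<not> primitive n x" for x P
    using dot_not_primitive[OF that(1) _ that(2)] dot_commute[OF that(1)] by auto
  show "correlation n a a' = ?r ^ (n - 2)" if "\<not> primitive n a" "\<not> primitive n a'"
    unfolding correlation_eq Q nprim(1,2)[OF a that(1)] nprim(1)[OF a' that(2)] by simp
  show "correlation n a a' = 0" if "primitive n a \<noteq> primitive n a'"
  proof (cases "primitive n a")
    case True
    then have a'n: "\<not> primitive n a'" using that by simp
    show ?thesis
      unfolding correlation_eq Q prim[OF a True] nprim(1,3)[OF a' a'n] by simp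
  next
    case False
    then have a'p: "primitive n a'" using that by simp
    show ?thesis
      unfolding correlation_eq Q nprim(1,2)[OF a False] prim[OF a' a'p] by simp
  qed
  show "correlation n a a' = real (card {b \<in> ?V. dot R n a b = \<one> \<and> dot R n a' b = \<one>}) - ?r ^ (n - 2)"
    if "primitive n a" "primitive n a'"
    unfolding correlation_eq Q prim[OF a that(1)] prim[OF a' that(2)] by simp
qed

text \<open>Here the joint count is exactly \<open>r^(n-2)\<close>, as for independent
  events.\<close>

lemma correlation_not_parallel:
  assumes a: "a \<in> vectors R n" and a': "a' \<in> vectors R n" and n: "n \<ge> 2"
    and prim: "primitive n a" "primitive n a'" and par: "\<not> parallel n a a'"
  shows "correlation n a a' = 0"
proof -
  let ?r = "real (card (carrier R))"
  have r: "?r > 0" using card_carrier_pos by simp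
  obtain k where k: "n = k + 2" using n by (metis le_add_diff_inverse2)
  have "real (card {b \<in> vectors R n. dot R n a b = \<one> \<and> dot R n a' b = \<one>}) * ?r ^ 2 = ?r ^ n"
    using arg_cong[OF card_solutions_not_parallel[OF a a' par], where f = real]
    by (simp only: of_nat_mult of_nat_power)
  also have "\<dots> = ?r ^ (n - 2) * ?r ^ 2"
    by (simp add: k power_add power2_eq_square)
  finally have "real (card {b \<in> vectors R n. dot R n a b = \<one> \<and> dot R n a' b = \<one>}) = ?r ^ (n - 2)"
    using r by simp
  then show ?thesis
    using correlation_cases(3)[OF a a' n prim] by simp
qed

text \<open>Strictness has a different source in each case: \<open>|M| < |R|\<close> if
  \<open>a\<close> is non-primitive, and the discarded term \<open>r^(n-2)\<close> of the pair
  \<open>(a, a)\<close> if it is primitive.\<close>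

lemma sum_correlation_less:
  assumes A: "A \<subseteq> vectors R n" and a: "a \<in> A" and n: "n \<ge> 2"
  shows "(\<Sum>a' \<in> A. correlation n a a') < real (card (carrier R) * card M) ^ (n - 1)"
proof -
  let ?r = "real (card (carrier R))" and ?m = "real (card M)"
  let ?V = "vectors R n"
  have r: "?r > 0" and m: "?m > 0" "?m < ?r"
    using card_carrier_pos card_M_pos card_M_less by simp_all
  obtain k where k: "n = k + 2" using n by (metis le_add_diff_inverse2)
  have fin: "finite ?V" by (rule finite_vectors[OF finite_carrier])
  have finA: "finite A" by (rule finite_subset[OF A fin])
  have aV: "a \<in> ?V" using a A by blast
  show ?thesis
  proof (cases "primitive n a")
    case False
    have "(\<Sum>a' \<in> A. correlation n a a') = (\<Sum>a' \<in> {a' \<in> A. \<not> primitive n a'}. correlation n a a')"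
      using finA A correlation_cases(2)[OF aV _ n] False by (intro sum.mono_neutral_right) auto
    also have "\<dots> = (\<Sum>a' \<in> {a' \<in> A. \<not> primitive n a'}. ?r ^ (n - 2))"
      using A correlation_cases(1)[OF aV _ n False] by (intro sum.cong) auto
    also have "\<dots> = card {a' \<in> A. \<not> primitive n a'} * ?r ^ (n - 2)"
      by simp
    also have "\<dots> \<le> card {a' \<in> ?V. \<not> primitive n a'} * ?r ^ (n - 2)"
      using A fin r by (intro mult_right_mono) (auto intro!: card_mono)
    also have "\<dots> = ?m ^ n * ?r ^ (n - 2)"
      by (simp add: card_not_primitive)
    also have "\<dots> = (?m ^ (n - 1) * ?r ^ (n - 2)) * ?m"
      by (simp add: k)
    \<comment> \<open>Of the \<open>n\<close> factors \<open>|M|\<close>, one is traded for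
      \<open>|R|\<close> to balance the exponents at \<open>n - 1\<close>.\<close>
    also have "\<dots> < (?m ^ (n - 1) * ?r ^ (n - 2)) * ?r"
      using m r by (intro mult_strict_left_mono) simp_all
    also have "\<dots> = real (card (carrier R) * card M) ^ (n - 1)"
      by (simp add: k power_mult_distrib)
    finally show ?thesis .
  next
    case True
    let ?c = "\<lambda>a'. card {b \<in> ?V. dot R n a b = \<one> \<and> dot R n a' b = \<one>}"
    let ?P = "{a' \<in> A. primitive n a' \<and> parallel n a a'}"
    have "(\<Sum>a' \<in> A. correlation n a a') = (\<Sum>a' \<in> ?P. correlation n a a')"
    proof (rule sum.mono_neutral_right[OF finA])
      show "\<forall>a'\<in>A - ?P. correlation n a a' = 0"
        using A True correlation_cases(2)[OF aV _ n] correlation_not_parallel[OF aV _ n True] by blast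
    qed blast
    also have "\<dots> = (\<Sum>a' \<in> ?P. real (?c a') - ?r ^ (n - 2))"
      using A correlation_cases(3)[OF aV _ n True] by (intro sum.cong) auto
    also have "\<dots> = (\<Sum>a' \<in> ?P. real (?c a')) - card ?P * ?r ^ (n - 2)"
      by (simp add: sum_subtractf)
    also have "\<dots> < (\<Sum>a' \<in> ?P. real (?c a'))"
    proof -
      have "a \<in> ?P" using a True parallel_refl[OF aV] by blast
      then have "card ?P > 0" using finA by (auto simp: card_gt_0_iff)
      then show ?thesis using r by simp
    qed
    also have "\<dots> \<le> (\<Sum>a' \<in> {a' \<in> ?V. parallel n a a'}. real (?c a'))"
      using A fin by (intro sum_mono2) auto
    also have "\<dots> \<le> real (card (carrier R) * card M) ^ (n - 1)"
    proof -
      let ?t = "real (card (carrier R) * card M)"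
      have t: "?t > 0" using r m by simp
      have "(\<Sum>a' \<in> {a' \<in> ?V. parallel n a a'}. real (?c a')) * ?t \<le> ?t ^ n"
        using of_nat_mono[OF sum_parallel_solutions_le[OF aV True], where 'a = real]
        by (simp only: of_nat_mult of_nat_sum of_nat_power)
      also have "?t ^ n = ?t ^ (n - 1) * ?t"
        by (simp add: k)
      finally show ?thesis using t by (simp only: mult_le_cancel_right_pos)
    qed
    finally show ?thesis .
  qed
qed

lemma second_moment_less:
  assumes A: "A \<subseteq> vectors R n" "A \<noteq> {}" and n: "n \<ge> 2"
  shows "(\<Sum>b \<in> vectors R n. (\<Sum>a \<in> A. deviation n a b)\<^sup>2)
    < card A * real (card (carrier R) * card M) ^ (n - 1)"
proof -
  have finA: "finite A"
    by (rule finite_subset[OF A(1) finite_vectors[OF finite_carrier]])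
  have "(\<Sum>b \<in> vectors R n. (\<Sum>a \<in> A. deviation n a b)\<^sup>2)
      = (\<Sum>b \<in> vectors R n. \<Sum>a \<in> A. \<Sum>a' \<in> A. deviation n a b * deviation n a' b)"
    by (simp add: power2_eq_square sum_product)
  also have "\<dots> = (\<Sum>a \<in> A. \<Sum>b \<in> vectors R n. \<Sum>a' \<in> A. deviation n a b * deviation n a' b)"
    by (rule sum.swap)
  also have "\<dots> = (\<Sum>a \<in> A. \<Sum>a' \<in> A. correlation n a a')"
    unfolding correlation_def by (intro sum.cong refl sum.swap)
  also have "\<dots> < (\<Sum>a \<in> A. real (card (carrier R) * card M) ^ (n - 1))"
    using finA A n by (intro sum_strict_mono sum_correlation_less) auto
  finally show ?thesis by simp
qed

lemma N1_deviation:
  assumes "A \<subseteq> vectors R n" "B \<subseteq> vectors R n"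
  shows "real (N1 R n A B) - real (card A) * real (card B) / card (carrier R)
    = (\<Sum>b \<in> B. \<Sum>a \<in> A. deviation n a b)"
proof -
  have fin: "finite A" "finite B"
    using assms finite_subset[OF _ finite_vectors[OF finite_carrier]] by auto
  have "{(a, b) \<in> A \<times> B. dot R n a b = \<one>} = A \<times> B \<inter> {x. dot R n (fst x) (snd x) = \<one>}"
    by auto
  then have "real (N1 R n A B) = (\<Sum>x \<in> A \<times> B. of_bool (dot R n (fst x) (snd x) = \<one>))"
    using fin by (simp add: N1_def sum_of_bool_eq)
  also have "\<dots> = (\<Sum>a \<in> A. \<Sum>b \<in> B. of_bool (dot R n a b = \<one>))"
    by (simp add: sum.cartesian_product case_prod_beta)
  also have "\<dots> = (\<Sum>b \<in> B. \<Sum>a \<in> A. of_bool (dot R n a b = \<one>))"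
    by (rule sum.swap)
  finally show ?thesis
    by (simp add: deviation_def sum_subtractf)
qed

text \<open>Cauchy--Schwarz over \<open>B\<close> costs a factor \<open>|B|\<close>; the sum of
  squares may then be extended from \<open>B\<close> to all vectors, where
  \<open>second_moment_less\<close> applies.\<close>

lemma N1_bound:
  assumes A: "A \<subseteq> vectors R n" "A \<noteq> {}" and B: "B \<subseteq> vectors R n" "B \<noteq> {}" and n: "n \<ge> 2"
  shows "(real (N1 R n A B) - real (card A) * real (card B) / card (carrier R))\<^sup>2
    < real (card (carrier R) * card M) ^ (n - 1) * (card A * card B)"
proof -
  have fin: "finite (vectors R n)" by (rule finite_vectors[OF finite_carrier])
  then have "card B > 0" using B finite_subset by (auto simp: card_gt_0_iff)
  let ?D = "\<lambda>b. \<Sum>a \<in> A. deviation n a b"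
  have "(\<Sum>b \<in> B. ?D b)\<^sup>2 \<le> (\<Sum>b \<in> B. (?D b)\<^sup>2) * card B"
    by (rule sum_squared_le_sum_of_squares)
  also have "(\<Sum>b \<in> B. (?D b)\<^sup>2) * card B \<le> (\<Sum>b \<in> vectors R n. (?D b)\<^sup>2) * card B"
    using B fin by (intro mult_right_mono sum_mono2) auto
  also have "\<dots> < (card A * real (card (carrier R) * card M) ^ (n - 1)) * card B"
    using second_moment_less[OF A n] \<open>card B > 0\<close> by (intro mult_strict_right_mono) auto
  finally show ?thesis
    unfolding N1_deviation[OF A(1) B(1)] by (simp add: mult_ac)
qed

end

section \<open>Translation into powers of \<open>q\<close>, and the density criterion\<close>

theorem theorem1p10:
  fixes R :: "('r, 'm) ring_scheme" and p :: 'r and q l n :: nat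
    and A B :: "(nat \<Rightarrow> 'r) set"
  assumes "finite_valuation_ring R"
    and "uniformizer R p"
    and "q = card (carrier (R Quot (PIdl\<^bsub>R\<^esub> p)))"
    and "odd q"
    and "l = nilpotency_degree R p"
    and "n \<ge> 2"
    and "A \<subseteq> vectors R n" and "A \<noteq> {}"
    and "B \<subseteq> vectors R n" and "B \<noteq> {}"
  shows "\<bar>real (N1 R n A B) - real q powr (- real l) * real (card A) * real (card B)\<bar>
           < real q powr ((real n - 1) * (real l - 1 / 2)) * sqrt (real (card A) * real (card B))
         \<and> (density R n A * density R n B \<ge> real q powr (- (real n - 1))
              \<longrightarrow> \<one>\<^bsub>R\<^esub> \<in> dot_set R n A B)"
proof -
  interpret finite_valuation_ring_uniformizer R p
    using assms(1,2)
    by (simp add: finite_valuation_ring_uniformizer_def finite_valuation_ring_uniformizer_axioms_def)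
  have q: "real q > 1" using q_gt_1 assms(3) by simp
  have l: "l \<ge> 1" using l_pos assms(5) by simp
  have r: "card (carrier R) = q ^ l" and m: "card M = q ^ (l - 1)"
    using card_carrier card_M by (simp_all add: assms(3,5))
  define X where "X = real (card A) * real (card B)"
  define T where "T = real q powr ((real n - 1) * (real l - 1 / 2))"
  define E where "E = real (N1 R n A B) - real q powr (- real l) * X"
  have T: "T > 0" using q by (simp add: T_def)
  have "card A > 0" "card B > 0"
    using assms finite_subset[OF _ finite_vectors[OF finite_carrier]] by (auto simp: card_gt_0_iff)
  then have X: "X > 0" by (simp add: X_def)
  \<comment> \<open>\<open>|R| |M| = q^(2l-1)\<close>, so its power \<open>n - 1\<close> is the
    square of the claimed constant \<open>T\<close>.\<close>
  have "real (q ^ l * q ^ (l - 1)) = real q powr (2 * real l - 1)"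
    using q l by (simp add: of_nat_diff flip: powr_realpow powr_add)
  then have "real (q ^ l * q ^ (l - 1)) ^ (n - 1) = real q powr ((real n - 1) * (2 * real l - 1))"
    using q assms(6) by (simp add: powr_power of_nat_diff mult.commute)
  also have "\<dots> = T\<^sup>2"
    using q by (simp add: T_def power2_eq_square algebra_simps flip: powr_add)
  finally have T2: "real (q ^ l * q ^ (l - 1)) ^ (n - 1) = T\<^sup>2" .
  have "E = real (N1 R n A B) - real (card A) * real (card B) / card (carrier R)"
    using q by (simp add: E_def X_def r powr_minus powr_realpow field_simps)
  then have E2: "E\<^sup>2 < T\<^sup>2 * X"
    using N1_bound[OF assms(7-10,6)] by (simp only: r m T2[unfolded of_nat_mult] X_def of_nat_mult)
  then have "\<bar>E\<bar> < sqrt (T\<^sup>2 * X)"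
    by (metis real_sqrt_abs real_sqrt_less_mono)
  then have bound: "\<bar>E\<bar> < T * sqrt X"
    using T by (simp add: real_sqrt_mult)
  have "\<one>\<^bsub>R\<^esub> \<in> dot_set R n A B" if dens: "density R n A * density R n B \<ge> real q powr (- (real n - 1))"
  proof (rule ccontr)
    assume "\<one>\<^bsub>R\<^esub> \<notin> dot_set R n A B"
    \<comment> \<open>Without a solution \<open>E = - q^(-l) X\<close>, so the bound on
      \<open>E\<close> reads \<open>q^(-2l) X < T^2\<close>. The density hypothesis gives
      \<open>X \<ge> q^(2ln-(n-1)) = q^(2l) T^2\<close>. The strict bound is what covers equality of
      densities.\<close>
    then have "{(a, b) \<in> A \<times> B. dot R n a b = \<one>\<^bsub>R\<^esub>} = {}"
      unfolding dot_set_def by force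
    then have "N1 R n A B = 0"
      by (simp only: N1_def card.empty)
    then have "(real q powr (- real l))\<^sup>2 * X * X < T\<^sup>2 * X"
      using E2 by (simp add: E_def power_mult_distrib power2_eq_square mult_ac)
    moreover have "(real q powr (- real l))\<^sup>2 = real q powr (- 2 * real l)"
      by (simp add: power2_eq_square flip: powr_add)
    ultimately have less: "real q powr (- 2 * real l) * X < T\<^sup>2"
      using X by simp
    have V: "real (card (vectors R n)) = real q powr (real l * real n)"
      using q by (simp add: card_vectors r powr_realpow powr_powr[symmetric])
    have "real q powr (- (real n - 1)) \<le> X / real q powr (2 * (real l * real n))"
      using dens q by (simp add: density_def V X_def flip: powr_add)
    then have "real q powr (- (real n - 1)) * real q powr (2 * (real l * real n)) \<le> X"
      using q by (simp add: field_simps)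
    then have "real q powr (- 2 * real l) * (real q powr (- (real n - 1)) * real q powr (2 * (real l * real n)))
        \<le> real q powr (- 2 * real l) * X"
      using q by (intro mult_left_mono) auto
    moreover have "real q powr (- 2 * real l) * (real q powr (- (real n - 1)) * real q powr (2 * (real l * real n))) = T\<^sup>2"
      using q by (simp add: T_def power2_eq_square algebra_simps flip: powr_add)
    ultimately show False using less by simp
  qed
  then show ?thesis
    using bound by (simp add: E_def T_def X_def mult.assoc)
qed

end
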